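(* Let $G=(V,E)$ be a finite graph with $V=I\cup B$ (disjoint union of interior and boundary vertices), let $f=(f_b)_{b\in B}\in\{-1,+1\}^B$ be a boundary condition, let $\beta>0$, and let $p_{\mathrm{V}}$ be the Ising distribution on $\{-1,+1\}^I$ with boundary condition $f$, $$p_{\mathrm{V}}(s)\propto \exp\Big(\beta\sum_{ij\in E}s_is_j+\beta\sum_{ib\in E}s_if_b\Big).$$ Suppose there is a map $m:V\to V$ such that: (i) $m(I)\subseteq I$, $m(B)\subseteq B$ and $m^2=\mathrm{id}$; (ii) for $i,j\in I$, $ij\in E$ if and only if $m(i)m(j)\in E$, and for $i\in I$, $b\in B$, $ib\in E$ if and only if $m(i)m(b)\in E$; (iii) $f_{m(b)}=-f_b$ for all $b\in B$. Let $\eta\in(0,1)$, let $P_{\mathrm{DF}}$ be the transition matrix of the double flip move and $P_{\mathrm{SW}}$ that of the Swendsen-Wang move with boundary condition $f$, and let $$P_{\mathrm{SWDF}}=\eta P_{\mathrm{DF}}+(1-\eta)P_{\mathrm{SW}}$$ be the transition matrix of the Swendsen-Wang algorithm with double flip. Then this algorithm satisfies detailed balance with respect to $p_{\mathrm{V}}$: for all $s,t\in\{-1,+1\}^I$, $$p_{\mathrm{V}}(s)\,P_{\mathrm{SWDF}}(s,t)=p_{\mathrm{V}}(t)\,P_{\mathrm{SWDF}}(t,s).$$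
   Context: The graph is simple and undirected. Every edge is either an interior edge $ij$ with $i,j\in I$, or an edge $ib$ joining an interior vertex $i\in I$ to a boundary vertex $b\in B$; the letters $i,j$ always denote vertices of $I$ and $b$ a vertex of $B$. Thus $\sum_{ij\in E}$ is the sum over interior edges (each unordered edge counted once) and $\sum_{ib\in E}$ the sum over interior-boundary edges. A spin configuration is $s=(s_i)_{i\in I}\in\{-1,+1\}^I$, and $\propto$ means equality up to the normalization constant making $p_{\mathrm{V}}$ a probability distribution on $\{-1,+1\}^I$. Double flip move: it deterministically sends $s$ to the configuration $t$ with $t_{m(i)}=-s_i$ for all $i\in I$; so $P_{\mathrm{DF}}(s,t)=1$ if $t_{m(i)}=-s_i$ for all $i\in I$, and $P_{\mathrm{DF}}(s,t)=0$ otherwise. Swendsen-Wang move (with boundary condition $f$), from $s$ to a new configuration $t$: (1) Generate a random edge configuration $w\in\{0,1\}^E$ with independent entries: for an interior edge $ij$, $w_{ij}=0$ if $s_i\ne s_j$, and if $s_i=s_j$ then $w_{ij}=1$ with probability $1-e^{-2\beta}$ and $w_{ij}=0$ with probability $e^{-2\beta}$; for an edge $ib$, the same rule with $s_j$ replaced by $f_b$. (2) Consider the connected components of the graph with vertex set $V$ and edge set $\{e\in E: w_e=1\}$. For each component containing a boundary vertex $b$, set $t_i=f_b$ for all interior vertices $i$ of the component (this is well defined, since for $w$ produced by step (1) all boundary vertices in one component have the same value of $f$). For each component containing only interior vertices, set all its spins $t_i$ to $+1$ or all to $-1$, with probability $1/2$ each, independently over components. Then $P_{\mathrm{SW}}(s,t)$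 is the probability that this procedure, started from $s$, outputs $t$. The combined algorithm performs, at each iteration, the double flip move with probability $\eta$ and the Swendsen-Wang move with probability $1-\eta$. *)

theory Defs
  imports "HOL-Probability.Probability"
begin

text \<open>
  A finite simple graph on the disjoint union of the interior vertices \<open>I\<close> and the boundary
  vertices \<open>B\<close>. An undirected edge is the two-element set of its end points; there are no edges
  between two boundary vertices.
\<close>

definition boundary_graph :: "'v set \<Rightarrow> 'v set \<Rightarrow> 'v set set \<Rightarrow> bool" where
  "boundary_graph I B E \<longleftrightarrow>
     finite I \<and> finite B \<and> I \<inter> B = {} \<and>
     (\<forall>e\<in>E. (\<exists>i\<in>I. \<exists>j\<in>I. i \<noteq> j \<and> e = {i, j}) \<or> (\<exists>i\<in>I. \<exists>b\<in>B. e = {i, b}))"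

text \<open>Configurations are extensional, so that each has exactly one representing function.\<close>

definition spin_configs :: "'v set \<Rightarrow> ('v \<Rightarrow> int) set" where
  "spin_configs I = I \<rightarrow>\<^sub>E {-1, 1}"

text \<open>For an interior edge \<open>e = {i, j}\<close>, the product over \<open>e\<close> is \<open>s i * s j\<close>.\<close>

definition ising_weight ::
    "'v set \<Rightarrow> 'v set \<Rightarrow> 'v set set \<Rightarrow> ('v \<Rightarrow> int) \<Rightarrow> real \<Rightarrow> ('v \<Rightarrow> int) \<Rightarrow> real" where
  "ising_weight I B E f \<beta> s =
     exp (\<beta> * (\<Sum>e | e \<in> E \<and> e \<subseteq> I. real_of_int (\<Prod>i\<in>e. s i))
        + \<beta> * (\<Sum>(i, b) | i \<in> I \<and> b \<in> B \<and> {i, b} \<in> E. real_of_int (s i * f b)))"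

definition ising_prob ::
    "'v set \<Rightarrow> 'v set \<Rightarrow> 'v set set \<Rightarrow> ('v \<Rightarrow> int) \<Rightarrow> real \<Rightarrow> ('v \<Rightarrow> int) \<Rightarrow> real" where
  "ising_prob I B E f \<beta> s =
     ising_weight I B E f \<beta> s / (\<Sum>t\<in>spin_configs I. ising_weight I B E f \<beta> t)"

definition P_DF :: "'v set \<Rightarrow> ('v \<Rightarrow> 'v) \<Rightarrow> ('v \<Rightarrow> int) \<Rightarrow> ('v \<Rightarrow> int) \<Rightarrow> real" where
  "P_DF I m s t = (if \<forall>i\<in>I. t (m i) = - s i then 1 else 0)"

definition with_boundary :: "'v set \<Rightarrow> ('v \<Rightarrow> int) \<Rightarrow> ('v \<Rightarrow> int) \<Rightarrow> 'v \<Rightarrow> int" where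
  "with_boundary I f s v = (if v \<in> I then s v else f v)"

text \<open>Step 1 of the Swendsen--Wang move; \<open>w e = True\<close> encodes \<open>w\<^sub>e = 1\<close>.\<close>

definition edge_pmf ::
    "'v set \<Rightarrow> 'v set set \<Rightarrow> ('v \<Rightarrow> int) \<Rightarrow> real \<Rightarrow> ('v \<Rightarrow> int) \<Rightarrow> ('v set \<Rightarrow> bool) pmf" where
  "edge_pmf I E f \<beta> s =
     Pi_pmf E False (\<lambda>e.
       if \<forall>u\<in>e. \<forall>v\<in>e. with_boundary I f s u = with_boundary I f s v
       then bernoulli_pmf (1 - exp (- 2 * \<beta>)) else return_pmf False)"

definition component :: "'v set set \<Rightarrow> ('v set \<Rightarrow> bool) \<Rightarrow> 'v \<Rightarrow> 'v set" where
  "component E w v = {(x, y). {x, y} \<in> E \<and> w {x, y}}\<^sup>* `` {v}"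

definition components :: "'v set \<Rightarrow> 'v set set \<Rightarrow> ('v set \<Rightarrow> bool) \<Rightarrow> 'v set set" where
  "components V E w = component E w ` V"

text \<open>
  Step 2: a spin for every component, independently. For every \<open>w\<close> in the support of
  \<^const>\<open>edge_pmf\<close>, all boundary vertices of a component carry the same value of \<open>f\<close>, so the
  choice of \<open>b\<close> below does not matter.
\<close>

definition component_spin_pmf ::
    "'v set \<Rightarrow> 'v set \<Rightarrow> 'v set set \<Rightarrow> ('v \<Rightarrow> int) \<Rightarrow> ('v set \<Rightarrow> bool) \<Rightarrow> ('v set \<Rightarrow> int) pmf" where
  "component_spin_pmf I B E f w =
     Pi_pmf (components (I \<union> B) E w) 0 (\<lambda>K.
       if K \<inter> B \<noteq> {} then return_pmf (f (SOME b. b \<in> K \<inter> B)) else pmf_of_set {-1, 1})"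

definition SW_pmf ::
    "'v set \<Rightarrow> 'v set \<Rightarrow> 'v set set \<Rightarrow> ('v \<Rightarrow> int) \<Rightarrow> real \<Rightarrow> ('v \<Rightarrow> int) \<Rightarrow> ('v \<Rightarrow> int) pmf" where
  "SW_pmf I B E f \<beta> s =
     bind_pmf (edge_pmf I E f \<beta> s) (\<lambda>w.
     bind_pmf (component_spin_pmf I B E f w) (\<lambda>c.
     return_pmf (\<lambda>i\<in>I. c (component E w i))))"

definition P_SW ::
    "'v set \<Rightarrow> 'v set \<Rightarrow> 'v set set \<Rightarrow> ('v \<Rightarrow> int) \<Rightarrow> real \<Rightarrow> ('v \<Rightarrow> int) \<Rightarrow> ('v \<Rightarrow> int) \<Rightarrow> real" where
  "P_SW I B E f \<beta> s t = pmf (SW_pmf I B E f \<beta> s) t"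

definition P_SWDF ::
    "'v set \<Rightarrow> 'v set \<Rightarrow> 'v set set \<Rightarrow> ('v \<Rightarrow> int) \<Rightarrow> real \<Rightarrow> ('v \<Rightarrow> 'v) \<Rightarrow> real
      \<Rightarrow> ('v \<Rightarrow> int) \<Rightarrow> ('v \<Rightarrow> int) \<Rightarrow> real" where
  "P_SWDF I B E f \<beta> m \<eta> s t = \<eta> * P_DF I m s t + (1 - \<eta>) * P_SW I B E f \<beta> s t"

end

theory Submission
  imports Defs
begin

text \<open>
  Up to the constant \<open>exp (\<beta> |E|)\<close>, the Ising weight of \<open>s\<close> is the product over all edges of \<open>1\<close> or
  \<open>exp (-2\<beta>)\<close>, according to whether \<open>s\<close> is constant on the edge. Hence the weight of \<open>s\<close> times the
  probability of the edge configuration \<open>w\<close> is a function of \<open>w\<close> alone as long as \<open>s\<close> is constant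
  on the edges of \<open>w\<close>, and \<open>0\<close> otherwise (the Edwards--Sokal coupling). Given such a \<open>w\<close>, the second
  step is uniform on the configurations that are constant on the edges of \<open>w\<close>, so every \<open>w\<close>
  contributes symmetrically to the detailed balance equation. The double flip
  is an involution that permutes the edges and preserves agreement along them.
\<close>

section \<open>Agreement of spins along open edges and components\<close>

definition agrees :: "'v set \<Rightarrow> ('v \<Rightarrow> int) \<Rightarrow> ('v \<Rightarrow> int) \<Rightarrow> 'v set \<Rightarrow> bool" where
  "agrees I f s e \<longleftrightarrow> (\<forall>u\<in>e. \<forall>v\<in>e. with_boundary I f s u = with_boundary I f s v)"

definition compatible ::
    "'v set \<Rightarrow> 'v set set \<Rightarrow> ('v \<Rightarrow> int) \<Rightarrow> ('v set \<Rightarrow> bool) \<Rightarrow> ('v \<Rightarrow> int) \<Rightarrow> bool" where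
  "compatible I E f w s \<longleftrightarrow> (\<forall>e\<in>E. w e \<longrightarrow> agrees I f s e)"

lemma agrees_pair:
  "agrees I f s {u, v} \<longleftrightarrow> with_boundary I f s u = with_boundary I f s v"
  unfolding agrees_def by auto

text \<open>The generating relation is symmetric because \<open>{x, y} = {y, x}\<close>, so its
  reflexive transitive closure is an equivalence relation and components are its classes.\<close>

lemma component_eq:
  assumes "x \<in> component E w v"
  shows "component E w x = component E w v"
proof -
  let ?R = "{(x, y). {x, y} \<in> E \<and> w {x, y}}"
  have "sym ?R" by (auto simp: sym_def insert_commute)
  then have "sym (?R\<^sup>*)" by (rule sym_rtrancl)
  moreover have vx: "(v, x) \<in> ?R\<^sup>*" using assms by (simp add: component_def)
  ultimately have "(x, v) \<in> ?R\<^sup>*" by (auto dest: symD)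
  with vx show ?thesis unfolding component_def by (auto intro: rtrancl_trans)
qed

lemma component_refl: "v \<in> component E w v"
  by (simp add: component_def)

lemma component_edge:
  assumes "{x, y} \<in> E" "w {x, y}"
  shows "component E w x = component E w y"
proof -
  have "y \<in> component E w x" using assms by (auto simp: component_def)
  then show ?thesis by (simp add: component_eq)
qed

lemma with_boundary_component:
  assumes "compatible I E f w s" "x \<in> component E w v"
  shows "with_boundary I f s x = with_boundary I f s v"
proof -
  have "(v, x) \<in> {(x, y). {x, y} \<in> E \<and> w {x, y}}\<^sup>*"
    using assms(2) by (simp add: component_def)
  then show ?thesis
  proof induction
    case (step y z)
    then have "agrees I f s {y, z}" using assms(1) by (auto simp: compatible_def)
    with step show ?case by (simp add: agrees_pair)
  qed simp
qed

section \<open>The Ising weight and the first Swendsen-Wang step as products over edges\<close>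

locale ising_graph =
  fixes I B :: "'v set" and E :: "'v set set" and f :: "'v \<Rightarrow> int" and \<beta> :: real
  assumes graph: "boundary_graph I B E"
    and boundary: "\<forall>b\<in>B. f b \<in> {-1, 1}"
    and beta: "\<beta> > 0"
begin

lemma finite_I: "finite I" and finite_B: "finite B" and disjoint: "I \<inter> B = {}"
  using graph by (auto simp: boundary_graph_def)

lemma edge_cases:
  assumes "e \<in> E"
  obtains i j where "i \<in> I" "j \<in> I" "i \<noteq> j" "e = {i, j}"
  | i b where "i \<in> I" "b \<in> B" "e = {i, b}"
proof -
  have "(\<exists>i\<in>I. \<exists>j\<in>I. i \<noteq> j \<and> e = {i, j}) \<or> (\<exists>i\<in>I. \<exists>b\<in>B. e = {i, b})"
    using graph assms by (simp add: boundary_graph_def)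
  then show thesis using that by (elim disjE bexE conjE)
qed

lemma edge_pair:
  assumes "e \<in> E"
  obtains u v where "u \<in> I" "v \<in> I \<union> B" "u \<noteq> v" "e = {u, v}"
  using assms
proof (cases rule: edge_cases)
  case (2 i b)
  then show ?thesis using that[of i b] disjoint by auto
qed (use that in auto)

lemma edge_subset: "e \<in> E \<Longrightarrow> e \<subseteq> I \<union> B"
  by (elim edge_pair) auto

lemma finite_E: "finite E"
  using edge_subset finite_I finite_B
  by (intro finite_subset[of E "Pow (I \<union> B)"]) auto

lemma with_boundary_values:
  assumes "s \<in> spin_configs I" "v \<in> I \<union> B"
  shows "with_boundary I f s v \<in> {-1, 1}"
  using assms boundary by (auto simp: with_boundary_def spin_configs_def PiE_iff)

lemma spin_product:
  assumes "s \<in> spin_configs I" "u \<in> I \<union> B" "v \<in> I \<union> B"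
  shows "with_boundary I f s u * with_boundary I f s v = (if agrees I f s {u, v} then 1 else -1)"
  using with_boundary_values[OF assms(1,2)] with_boundary_values[OF assms(1,3)]
  by (auto simp: agrees_pair)

text \<open>Each edge adds \<beta> or -\<beta> to the exponent. Taking \<open>exp \<beta>\<close>
  out of every factor leaves the penalty \<open>exp (- 2 * \<beta>)\<close> for disagreement, which
  equals the probability that an agreeing edge is closed.\<close>

lemma ising_weight_eq:
  assumes s: "s \<in> spin_configs I"
  shows "ising_weight I B E f \<beta> s =
    exp \<beta> ^ card E * (\<Prod>e\<in>E. if agrees I f s e then 1 else exp (- 2 * \<beta>))"
proof -
  define val :: "'v set \<Rightarrow> real" where "val e = (if agrees I f s e then 1 else -1)" for e
  define EI where "EI = {e \<in> E. e \<subseteq> I}"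
  define IB where "IB = {(i, b). i \<in> I \<and> b \<in> B \<and> {i, b} \<in> E}"
  have 1: "real_of_int (\<Prod>i\<in>e. s i) = val e" if e: "e \<in> EI" for e
  proof -
    from e have "e \<in> E" "e \<subseteq> I" by (auto simp: EI_def)
    then obtain i j where ij: "i \<in> I" "j \<in> I" "i \<noteq> j" "e = {i, j}"
      using disjoint by (elim edge_cases) auto
    have "(\<Prod>i\<in>e. s i) = with_boundary I f s i * with_boundary I f s j"
      using ij by (simp add: with_boundary_def)
    then show ?thesis using spin_product[OF s, of i j] ij by (simp add: val_def)
  qed
  have 2: "real_of_int (s i * f b) = val {i, b}" if ib: "(i, b) \<in> IB" for i b
  proof -
    from ib have "i \<in> I" "b \<in> B" "b \<notin> I" using disjoint by (auto simp: IB_def)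
    then show ?thesis using spin_product[OF s, of i b]
      by (simp add: val_def with_boundary_def)
  qed
  \<comment> \<open>Turns the sum over pairs into a sum over unordered edges. Disjointness of
    \<open>I\<close> and \<open>B\<close> tells which end point of such an edge is the boundary
    one.\<close>
  have bij: "bij_betw (\<lambda>(i, b). {i, b}) IB (E - EI)"
    unfolding bij_betw_def
  proof
    show "inj_on (\<lambda>(i, b). {i, b}) IB"
      using disjoint by (auto simp: inj_on_def IB_def doubleton_eq_iff)
    show "(\<lambda>(i, b). {i, b}) ` IB = E - EI"
    proof (intro equalityI subsetI)
      fix e assume e: "e \<in> E - EI"
      then have "e \<in> E" by simp
      then show "e \<in> (\<lambda>(i, b). {i, b}) ` IB"
        by (cases rule: edge_cases) (use e in \<open>auto simp: EI_def IB_def\<close>)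
    qed (use disjoint in \<open>auto simp: IB_def EI_def\<close>)
  qed
  have "(\<Sum>e\<in>EI. real_of_int (\<Prod>i\<in>e. s i)) = (\<Sum>e\<in>EI. val e)"
    by (intro sum.cong refl 1)
  moreover have "(\<Sum>(i, b)\<in>IB. real_of_int (s i * f b)) = (\<Sum>e\<in>E - EI. val e)"
    unfolding sum.reindex_bij_betw[OF bij, symmetric] by (intro sum.cong) (use 2 in auto)
  moreover have "(\<Sum>e\<in>E. val e) = (\<Sum>e\<in>E - EI. val e) + (\<Sum>e\<in>EI. val e)"
    by (rule sum.subset_diff) (auto simp: EI_def finite_E)
  ultimately have "ising_weight I B E f \<beta> s = exp (\<Sum>e\<in>E. \<beta> * val e)"
    unfolding ising_weight_def EI_def[symmetric] IB_def[symmetric]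
    by (simp add: algebra_simps flip: sum_distrib_left)
  also have "\<dots> = (\<Prod>e\<in>E. exp (\<beta> * val e))" by (rule exp_sum[OF finite_E])
  also have "\<dots> = (\<Prod>e\<in>E. exp \<beta> * (if agrees I f s e then 1 else exp (- 2 * \<beta>)))"
    by (intro prod.cong) (auto simp: val_def simp flip: exp_add)
  finally show ?thesis by (simp add: prod.distrib)
qed

text \<open>A closed edge yields \<open>exp (- 2 * \<beta>)\<close> in either case: as closing
  probability if the spins agree, as penalty if they differ. An open edge yields
  \<open>1 - exp (- 2 * \<beta>)\<close> or, if the spins differ, 0. So \<open>s\<close> enters only
  through compatibility.\<close>

lemma weight_edge_pmf:
  assumes s: "s \<in> spin_configs I" and w: "w \<in> PiE_dflt E False (\<lambda>_. UNIV)"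
  shows "ising_weight I B E f \<beta> s * pmf (edge_pmf I E f \<beta> s) w =
    (if compatible I E f w s
     then exp \<beta> ^ card E * (\<Prod>e\<in>E. if w e then 1 - exp (- 2 * \<beta>) else exp (- 2 * \<beta>)) else 0)"
proof -
  have "pmf (edge_pmf I E f \<beta> s) w = (\<Prod>e\<in>E. pmf (if agrees I f s e
       then bernoulli_pmf (1 - exp (- 2 * \<beta>)) else return_pmf False) (w e))"
    unfolding edge_pmf_def agrees_def[symmetric] by (rule pmf_Pi') (use finite_E w in \<open>auto simp: PiE_dflt_def\<close>)
  then have eq: "ising_weight I B E f \<beta> s * pmf (edge_pmf I E f \<beta> s) w =
      exp \<beta> ^ card E * (\<Prod>e\<in>E. (if agrees I f s e then 1 else exp (- 2 * \<beta>)) *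
        pmf (if agrees I f s e
          then bernoulli_pmf (1 - exp (- 2 * \<beta>)) else return_pmf False) (w e))"
    (is "_ = _ * prod ?g E")
    by (simp add: ising_weight_eq[OF s] prod.distrib)
  show ?thesis
  proof (cases "compatible I E f w s")
    case True
    have "prod ?g E = (\<Prod>e\<in>E. if w e then 1 - exp (- 2 * \<beta>) else exp (- 2 * \<beta>))"
      \<comment> \<open>Positivity of \<beta> puts the Bernoulli parameter in the unit
        interval.\<close>
      using True beta by (intro prod.cong) (auto simp: compatible_def)
    with True eq show ?thesis by simp
  next
    case False
    then obtain e where e: "e \<in> E" "w e" "\<not> agrees I f s e" by (auto simp: compatible_def)
    then have "?g e = 0" by simp
    with e(1) have "prod ?g E = 0" using finite_E by (metis (lifting) prod_zero)
    with False eq show ?thesis by simp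
  qed
qed

section \<open>The second step: uniform choice among compatible configurations\<close>

definition spin_step :: "('v set \<Rightarrow> bool) \<Rightarrow> ('v \<Rightarrow> int) pmf" where
  "spin_step w = map_pmf (\<lambda>c. \<lambda>i\<in>I. c (component E w i)) (component_spin_pmf I B E f w)"

lemma finite_components: "finite (components (I \<union> B) E w)"
  by (simp add: components_def finite_I finite_B)

lemma set_component_spin_pmf:
  "set_pmf (component_spin_pmf I B E f w) =
    PiE_dflt (components (I \<union> B) E w) 0
      (\<lambda>K. if K \<inter> B \<noteq> {} then {f (SOME b. b \<in> K \<inter> B)} else {-1, 1})"
  unfolding component_spin_pmf_def
  by (subst set_Pi_pmf[OF finite_components]) (auto simp: PiE_dflt_def)

lemma component_spin_pmf_boundary:
  assumes "c \<in> set_pmf (component_spin_pmf I B E f w)"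
    and "K \<in> components (I \<union> B) E w" "K \<inter> B \<noteq> {}"
  shows "c K = f (SOME b. b \<in> K \<inter> B)"
proof -
  have "c K \<in> (if K \<inter> B \<noteq> {} then {f (SOME b. b \<in> K \<inter> B)} else {-1, 1})"
    using assms(1,2) unfolding set_component_spin_pmf PiE_dflt_def by blast
  with assms(3) show ?thesis by (simp only: if_True not_False_eq_True singleton_iff)
qed

text \<open>A compatible \<open>s\<close> is constant on the component and equals \<open>f\<close>
  at its boundary vertices, so the vertex picked by \<open>SOME\<close> is irrelevant.\<close>

lemma boundary_choice:
  assumes s: "compatible I E f w s" and b: "b \<in> component E w v" "b \<in> B"
  shows "f (SOME b. b \<in> component E w v \<inter> B) = with_boundary I f s v"
proof -
  let ?b = "SOME b. b \<in> component E w v \<inter> B"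
  have "?b \<in> component E w v \<inter> B" using b by (metis IntI someI)
  then have "with_boundary I f s ?b = with_boundary I f s v" "?b \<notin> I"
    using with_boundary_component[OF s] disjoint by auto
  then show ?thesis by (simp add: with_boundary_def)
qed

text \<open>The new spins, extended by \<open>f\<close>, depend only on the component. At a boundary
  vertex this requires the forced value to be \<open>f\<close> there, which the compatible
  \<open>s\<close> guarantees.\<close>

lemma spin_step_support:
  assumes s: "compatible I E f w s" and t: "pmf (spin_step w) t \<noteq> 0"
  shows "compatible I E f w t"
proof -
  from t obtain c where c: "c \<in> set_pmf (component_spin_pmf I B E f w)"
    and tc: "t = (\<lambda>i\<in>I. c (component E w i))"
    unfolding set_pmf_iff[symmetric] by (auto simp: spin_step_def)
  have wb: "with_boundary I f t v = c (component E w v)" if v: "v \<in> I \<union> B" for v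
  proof (cases "v \<in> I")
    case False
    with v have "v \<in> B" by auto
    then have "component E w v \<inter> B \<noteq> {}" using component_refl by fast
    moreover have "component E w v \<in> components (I \<union> B) E w" using v by (auto simp: components_def)
    ultimately have "c (component E w v) = f (SOME b. b \<in> component E w v \<inter> B)"
      by (intro component_spin_pmf_boundary[OF c])
    also have "\<dots> = with_boundary I f s v"
      using boundary_choice[OF s component_refl \<open>v \<in> B\<close>] .
    finally show ?thesis using False by (simp add: with_boundary_def)
  qed (simp add: with_boundary_def tc)
  show ?thesis
    unfolding compatible_def
  proof (intro ballI impI)
    fix e assume e: "e \<in> E" "w e"
    then obtain u v where "u \<in> I" "v \<in> I \<union> B" "e = {u, v}" by (elim edge_pair)
    then show "agrees I f t e"
      using wb component_edge[of u v E w] e by (simp add: agrees_pair)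
  qed
qed

text \<open>Components that meet \<open>I\<close> can be read off from the resulting configuration;
  components without interior vertices carry a forced value. Hence each outcome comes from a single
  component colouring.\<close>

lemma spin_step_map_inj:
  "inj_on (\<lambda>c. \<lambda>i\<in>I. c (component E w i)) (set_pmf (component_spin_pmf I B E f w))"
proof (rule inj_onI, rule ext)
  fix c d K
  assume c: "c \<in> set_pmf (component_spin_pmf I B E f w)"
    and d: "d \<in> set_pmf (component_spin_pmf I B E f w)"
    and eq: "(\<lambda>i\<in>I. c (component E w i)) = (\<lambda>i\<in>I. d (component E w i))"
  consider "K \<notin> components (I \<union> B) E w" | i where "i \<in> I" "K = component E w i"
    | b where "b \<in> B" "K = component E w b"
    by (auto simp: components_def)
  then show "c K = d K"
  proof cases
    case 1
    \<comment> \<open>Off the components both colourings take the default value 0.\<close>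
    then show ?thesis using c d unfolding set_component_spin_pmf PiE_dflt_def by simp
  next
    case 2
    then show ?thesis using fun_cong[OF eq, of i] by simp
  next
    case 3
    then have "K \<in> components (I \<union> B) E w" "K \<inter> B \<noteq> {}"
      using component_refl[of b E w] by (auto simp: components_def)
    then show ?thesis
      using component_spin_pmf_boundary[OF c] component_spin_pmf_boundary[OF d] by simp
  qed
qed

text \<open>By injectivity only one colouring produces \<open>t\<close>; it has a factor 1/2 for
  each free component and 1 for each forced one. The value therefore does not depend on
  \<open>t\<close>.\<close>

lemma pmf_spin_step:
  assumes t: "t \<in> spin_configs I" and comp: "compatible I E f w t"
  shows "pmf (spin_step w) t =
    (\<Prod>K\<in>components (I \<union> B) E w. if K \<inter> B \<noteq> {} then 1 else 1 / 2)"
proof -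
  \<comment> \<open>The colouring that produces \<open>t\<close>: the spin at any representative of
    the component, with the default value 0 elsewhere so that \<open>c\<close> lies in the
    support.\<close>
  define c where
    "c K = (if K \<in> components (I \<union> B) E w
      then with_boundary I f t (SOME v. v \<in> I \<union> B \<and> K = component E w v) else 0)" for K
  have c_eq: "c (component E w v) = with_boundary I f t v" if v: "v \<in> I \<union> B" for v
  proof -
    define x where "x = (SOME x. x \<in> I \<union> B \<and> component E w v = component E w x)"
    have "x \<in> I \<union> B \<and> component E w v = component E w x"
      unfolding x_def by (rule someI[of _ v]) (use v in simp)
    then have "x \<in> component E w v" using component_refl[of x E w] by simp
    then have "with_boundary I f t x = with_boundary I f t v"
      by (rule with_boundary_component[OF comp])
    moreover have "component E w v \<in> components (I \<union> B) E w"
      using v by (simp add: components_def)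
    ultimately show ?thesis unfolding c_def x_def by (simp only: if_True)
  qed
  have c_boundary: "c K = f (SOME b. b \<in> K \<inter> B)"
    if "K \<in> components (I \<union> B) E w" "K \<inter> B \<noteq> {}" for K
  proof -
    from that(1) obtain v where v: "v \<in> I \<union> B" "K = component E w v"
      unfolding components_def by (elim imageE)
    from that(2) have "\<exists>b. b \<in> component E w v \<inter> B"
      unfolding v(2) by (simp only: ex_in_conv not_False_eq_True)
    then obtain b where b: "b \<in> component E w v" "b \<in> B"
      by (elim exE IntE)
    show ?thesis
      unfolding v(2) c_eq[OF v(1)] by (rule boundary_choice[OF comp b, symmetric])
  qed
  have c_values: "c K \<in> {-1, 1}" if "K \<in> components (I \<union> B) E w" for K
  proof -
    from that obtain v where v: "v \<in> I \<union> B" "K = component E w v"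
      unfolding components_def by (elim imageE)
    show ?thesis
      unfolding v(2) c_eq[OF v(1)] by (rule with_boundary_values[OF t v(1)])
  qed
  have supp: "c \<in> set_pmf (component_spin_pmf I B E f w)"
    unfolding set_component_spin_pmf PiE_dflt_def
  proof (intro CollectI allI conjI impI)
    fix K assume K: "K \<in> components (I \<union> B) E w"
    show "c K \<in> (if K \<inter> B \<noteq> {} then {f (SOME b. b \<in> K \<inter> B)} else {-1, 1})"
    proof (cases "K \<inter> B = {}")
      case True
      with c_values[OF K] show ?thesis by simp
    next
      case False
      with c_boundary[OF K False] show ?thesis by (simp only: if_True not_False_eq_True singleton_iff)
    qed
  next
    fix K assume "K \<notin> components (I \<union> B) E w"
    then show "c K = 0" unfolding c_def by (rule if_not_P)
  qed
  have "(\<lambda>i\<in>I. c (component E w i)) = t"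
  proof
    fix i show "(\<lambda>i\<in>I. c (component E w i)) i = t i"
      \<comment> \<open>Outside \<open>I\<close> both sides are \<open>undefined\<close>, since
        \<open>t\<close> is extensional.\<close>
      using c_eq[of i] PiE_arb[OF t[unfolded spin_configs_def], of i]
      by (cases "i \<in> I") (simp_all add: with_boundary_def)
  qed
  then have "pmf (spin_step w) t = pmf (component_spin_pmf I B E f w) c"
    using pmf_map_inj[OF spin_step_map_inj supp] by (simp add: spin_step_def)
  also have "\<dots> = (\<Prod>K\<in>components (I \<union> B) E w. pmf
      (if K \<inter> B \<noteq> {} then return_pmf (f (SOME b. b \<in> K \<inter> B)) else pmf_of_set {-1, 1}) (c K))"
    unfolding component_spin_pmf_def
    by (rule pmf_Pi'[OF finite_components]) (simp only: c_def if_False)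
  also have "\<dots> = (\<Prod>K\<in>components (I \<union> B) E w. if K \<inter> B \<noteq> {} then 1 else 1 / 2)"
  proof (intro prod.cong refl)
    fix K assume K: "K \<in> components (I \<union> B) E w"
    show "pmf (if K \<inter> B \<noteq> {} then return_pmf (f (SOME b. b \<in> K \<inter> B)) else pmf_of_set {-1, 1}) (c K)
        = (if K \<inter> B \<noteq> {} then 1 else 1 / 2)"
    proof (cases "K \<inter> B = {}")
      case True
      with c_values[OF K] show ?thesis by auto
    next
      case False
      with c_boundary[OF K False] show ?thesis
        by (simp only: if_True not_False_eq_True pmf_return) simp
    qed
  qed
  finally show ?thesis .
qed

section \<open>Detailed balance for the Swendsen-Wang move\<close>

lemma P_SW_eq:
  "P_SW I B E f \<beta> s t = (\<Sum>w\<in>PiE_dflt E False (\<lambda>_. UNIV).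
    pmf (spin_step w) t * pmf (edge_pmf I E f \<beta> s) w)"
proof -
  have SW: "SW_pmf I B E f \<beta> s = bind_pmf (edge_pmf I E f \<beta> s) spin_step"
    by (simp add: SW_pmf_def spin_step_def[abs_def] map_pmf_def)
  \<comment> \<open>The support lies in the finite set of edge configurations that are
    \<open>False\<close> off \<open>E\<close>, so the mixture is a finite sum.\<close>
  have "w \<in> PiE_dflt E False (\<lambda>_. UNIV)" if "w \<in> set_pmf (edge_pmf I E f \<beta> s)" for w
    using subsetD[OF set_Pi_pmf_subset[OF finite_E] that[unfolded edge_pmf_def]]
    by (simp add: PiE_dflt_def)
  moreover have "finite (PiE_dflt E False (\<lambda>_. UNIV :: bool set))"
    by (intro finite_PiE_dflt finite_E) simp
  ultimately show ?thesis
    unfolding P_SW_def SW pmf_bind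
    by (subst integral_measure_pmf[of "PiE_dflt E False (\<lambda>_. UNIV)"]) (simp_all add: mult.commute)
qed

text \<open>Balance holds for each \<open>w\<close> separately. If both configurations are
  compatible, all factors depend on \<open>w\<close> alone. If just one is, one side vanishes by the
  edge weights and the other by \<open>spin_step_support\<close>. If neither is, both edge weights
  vanish.\<close>

lemma detailed_balance_SW:
  assumes s: "s \<in> spin_configs I" and t: "t \<in> spin_configs I"
  shows "ising_weight I B E f \<beta> s * P_SW I B E f \<beta> s t =
    ising_weight I B E f \<beta> t * P_SW I B E f \<beta> t s"
proof -
  have "ising_weight I B E f \<beta> s * (pmf (spin_step w) t * pmf (edge_pmf I E f \<beta> s) w) =
      ising_weight I B E f \<beta> t * (pmf (spin_step w) s * pmf (edge_pmf I E f \<beta> t) w)"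
    if "w \<in> PiE_dflt E False (\<lambda>_. UNIV)" for w
  proof -
    note weights = weight_edge_pmf[OF s that] weight_edge_pmf[OF t that]
    have "ising_weight I B E f \<beta> s * pmf (edge_pmf I E f \<beta> s) w * pmf (spin_step w) t =
      ising_weight I B E f \<beta> t * pmf (edge_pmf I E f \<beta> t) w * pmf (spin_step w) s"
    proof (cases "compatible I E f w s")
      case cs: True
      show ?thesis
      proof (cases "compatible I E f w t")
        case ct: True
        show ?thesis
          unfolding weights pmf_spin_step[OF s cs] pmf_spin_step[OF t ct] by (simp only: cs ct)
      next
        case ct: False
        with cs have "pmf (spin_step w) t = 0" using spin_step_support by blast
        with ct show ?thesis unfolding weights by (simp only: if_False mult_zero_left mult_zero_right)
      qed
    next
      case cs: False
      show ?thesis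
      proof (cases "compatible I E f w t")
        case True
        with cs have "pmf (spin_step w) s = 0" using spin_step_support by blast
        with cs show ?thesis unfolding weights by (simp only: if_False mult_zero_left mult_zero_right)
      next
        case False
        with cs show ?thesis unfolding weights by (simp only: if_False mult_zero_left)
      qed
    qed
    then show ?thesis by (simp only: mult_ac)
  qed
  then show ?thesis
    unfolding P_SW_eq sum_distrib_left by (rule sum.cong[OF refl])
qed

end

section \<open>The double flip\<close>

locale ising_graph_flip = ising_graph I B E f \<beta>
  for I B :: "'v set" and E :: "'v set set" and f :: "'v \<Rightarrow> int" and \<beta> :: real +
  fixes m :: "'v \<Rightarrow> 'v"
  assumes m_I: "m ` I \<subseteq> I" and m_B: "m ` B \<subseteq> B" and m_m: "\<forall>v\<in>I \<union> B. m (m v) = v"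
    and m_II: "\<forall>i\<in>I. \<forall>j\<in>I. {i, j} \<in> E \<longleftrightarrow> {m i, m j} \<in> E"
    and m_IB: "\<forall>i\<in>I. \<forall>b\<in>B. {i, b} \<in> E \<longleftrightarrow> {m i, m b} \<in> E"
    and m_f: "\<forall>b\<in>B. f (m b) = - f b"
begin

lemma image_edge:
  assumes "e \<in> E"
  shows "m ` e \<in> E"
  using assms
proof (cases rule: edge_cases)
  case (1 i j)
  then show ?thesis using assms m_II by (metis image_insert image_empty)
next
  case (2 i b)
  then show ?thesis using assms m_IB by (metis image_insert image_empty)
qed

lemma image_image_edge:
  assumes "e \<in> E"
  shows "m ` m ` e = e"
  unfolding image_image using assms edge_subset m_m by (subst image_cong[of e e _ "\<lambda>x. x"]) auto

text \<open>Since \<open>f\<close> is odd under \<open>m\<close>, the relation between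
  \<open>t\<close> and \<open>s\<close> extends to boundary vertices. A common sign change preserves
  agreement, and \<open>m\<close> permutes the edges, so the edge product is merely
  reindexed.\<close>

lemma ising_weight_flip:
  assumes s: "s \<in> spin_configs I" and t: "t \<in> spin_configs I" and st: "\<forall>i\<in>I. t (m i) = - s i"
  shows "ising_weight I B E f \<beta> t = ising_weight I B E f \<beta> s"
proof -
  have bij: "bij_betw ((`) m) E E"
    by (rule bij_betwI[where g = "(`) m"]) (auto simp: image_edge image_image_edge)
  have wb: "with_boundary I f t (m v) = - with_boundary I f s v" if "v \<in> I \<union> B" for v
    using that st m_f m_I m_B disjoint by (auto simp: with_boundary_def)
  have "agrees I f t (m ` e) = agrees I f s e" if "e \<in> E" for e
    using edge_subset[OF that] wb unfolding agrees_def by (auto simp: subset_iff)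
  then show ?thesis
    unfolding ising_weight_eq[OF s] ising_weight_eq[OF t]
    by (subst prod.reindex_bij_betw[OF bij, symmetric]) (simp cong: prod.cong)
qed

text \<open>Replacing \<open>i\<close> by \<open>m i\<close> shows that \<open>P_DF\<close> is
  symmetric, because \<open>m\<close> is an involution; where it is nonzero the two weights
  coincide.\<close>

lemma detailed_balance_DF:
  assumes s: "s \<in> spin_configs I" and t: "t \<in> spin_configs I"
  shows "ising_weight I B E f \<beta> s * P_DF I m s t = ising_weight I B E f \<beta> t * P_DF I m t s"
proof -
  have "(\<forall>i\<in>I. t (m i) = - s i) \<longleftrightarrow> (\<forall>i\<in>I. s (m i) = - t i)"
    using m_I m_m by (metis UnCI image_subset_iff minus_minus)
  then show ?thesis using ising_weight_flip[OF s t] by (auto simp: P_DF_def)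
qed

end

theorem theorem2:
  fixes I B :: "'v set" and E :: "'v set set" and f :: "'v \<Rightarrow> int"
    and m :: "'v \<Rightarrow> 'v" and \<beta> \<eta> :: real
  assumes "boundary_graph I B E"
    and "\<forall>b\<in>B. f b \<in> {-1, 1}"
    and "\<beta> > 0"
    and "m ` I \<subseteq> I" and "m ` B \<subseteq> B" and "\<forall>v\<in>I \<union> B. m (m v) = v"
    and "\<forall>i\<in>I. \<forall>j\<in>I. {i, j} \<in> E \<longleftrightarrow> {m i, m j} \<in> E"
    and "\<forall>i\<in>I. \<forall>b\<in>B. {i, b} \<in> E \<longleftrightarrow> {m i, m b} \<in> E"
    and "\<forall>b\<in>B. f (m b) = - f b"
    and "0 < \<eta>" and "\<eta> < 1"
  shows "\<forall>s\<in>spin_configs I. \<forall>t\<in>spin_configs I.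
    ising_prob I B E f \<beta> s * P_SWDF I B E f \<beta> m \<eta> s t =
    ising_prob I B E f \<beta> t * P_SWDF I B E f \<beta> m \<eta> t s"
proof (intro ballI)
  fix s t assume st: "s \<in> spin_configs I" "t \<in> spin_configs I"
  interpret ising_graph_flip I B E f \<beta> m
    using assms by unfold_locales
  \<comment> \<open>Detailed balance is linear in the transition matrix and unaffected by the
    normalization, so it is checked with weights, move by move.\<close>
  let ?W = "ising_weight I B E f \<beta>"
  have "?W s * P_SWDF I B E f \<beta> m \<eta> s t =
      \<eta> * (?W s * P_DF I m s t) + (1 - \<eta>) * (?W s * P_SW I B E f \<beta> s t)"
    by (simp add: P_SWDF_def algebra_simps)
  also have "\<dots> = \<eta> * (?W t * P_DF I m t s) + (1 - \<eta>) * (?W t * P_SW I B E f \<beta> t s)"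
    by (simp only: detailed_balance_DF[OF st] detailed_balance_SW[OF st])
  also have "\<dots> = ?W t * P_SWDF I B E f \<beta> m \<eta> t s"
    by (simp add: P_SWDF_def algebra_simps)
  finally show "ising_prob I B E f \<beta> s * P_SWDF I B E f \<beta> m \<eta> s t =
      ising_prob I B E f \<beta> t * P_SWDF I B E f \<beta> m \<eta> t s"
    by (simp add: ising_prob_def)
qed

end
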